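(* Let $d\in\mathbb{N}$ and suppose that $\mathcal{L} \subseteq \mathbb{R}^{2d}$ is a lattice which satisfies one of the following four conditions: (1) $\mathcal{L}$ is symplectic, i.e. $\mathcal{L}=\alpha S \mathbb{Z}^{2d}$ for some $\alpha>0$ and some $S \in \mathrm{Sp}_{2d}(\mathbb{R})$; (2) $\mathcal{L}$ is rectangular, i.e. $\mathcal{L}=D\mathbb{Z}^{2d}$ for some invertible diagonal matrix $D$; (3) $\mathcal{L}$ is separable, i.e. $\mathcal{L} = \mathcal{A} \times \mathcal{B}$ with $\mathcal{A},\mathcal{B}$ lattices in $\mathbb{R}^d$; (4) $\mathcal{L}=\alpha \mathbb{Z}^d \times \beta \mathbb{Z}^d$ for some $\alpha,\beta \in \mathbb{R} \setminus \{ 0 \}$. Then for every window function $g \in L^2(\mathbb{R}^d)$ there exist $f_1,f_2 \in L^2(\mathbb{R}^d)$ such that $|V_g f_1(z)| = |V_g f_2(z)|$ for all $z \in \mathcal{L}$, and there is no $\nu\in\mathbb{C}$ with $|\nu|=1$ and $f_1=\nu f_2$.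
   Context: For $f,g\in L^2(\mathbb{R}^d)$ the short-time Fourier transform is $V_gf(x,\omega)=\int_{\mathbb{R}^d} f(t)\overline{g(t-x)}e^{-2\pi i \omega\cdot t}\,dt$, $x,\omega\in\mathbb{R}^d$. A lattice in $\mathbb{R}^n$ is a set $M\mathbb{Z}^n$ with $M\in\mathrm{GL}_n(\mathbb{R})$. With $\mathcal{J}=\begin{pmatrix}0&-I_d\\ I_d&0\end{pmatrix}$, $\mathrm{Sp}_{2d}(\mathbb{R})=\{S\in\mathrm{GL}_{2d}(\mathbb{R}): S^T\mathcal{J}S=\mathcal{J}\}$. *)

theory Defs
  imports "HOL-Analysis.Analysis"
begin

definition int_vecs :: "(real ^ 'n::finite) set" where
  "int_vecs = {k. \<forall>i. k $ i \<in> \<int>}"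

definition is_lattice :: "(real ^ 'n::finite) set \<Rightarrow> bool" where
  "is_lattice L \<longleftrightarrow> (\<exists>M :: real ^ 'n ^ 'n. invertible M \<and> L = (\<lambda>k. M *v k) ` int_vecs)"

text \<open>\<R>^{2d} is modelled as real ^ ('d + 'd); the Inl-coordinates are the
  position variables x, the Inr-coordinates the frequency variables \<omega>.\<close>
definition pos :: "real ^ ('d::finite + 'd) \<Rightarrow> real ^ 'd" where
  "pos z = (\<chi> i. z $ Inl i)"

definition freq :: "real ^ ('d::finite + 'd) \<Rightarrow> real ^ 'd" where
  "freq z = (\<chi> i. z $ Inr i)"

definition symp_J :: "real ^ ('d::finite + 'd) ^ ('d + 'd)" where
  "symp_J = (\<chi> a b. case (a, b) of
      (Inl i, Inr j) \<Rightarrow> (if i = j then -1 else 0)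
    | (Inr i, Inl j) \<Rightarrow> (if i = j then 1 else 0)
    | _ \<Rightarrow> 0)"

definition symplectic :: "real ^ ('d::finite + 'd) ^ ('d + 'd) \<Rightarrow> bool" where
  "symplectic S \<longleftrightarrow> invertible S \<and> transpose S ** symp_J ** S = symp_J"

definition diagonal_mat :: "real ^ 'n ^ 'n \<Rightarrow> bool" where
  "diagonal_mat D \<longleftrightarrow> (\<forall>i j. i \<noteq> j \<longrightarrow> D $ i $ j = 0)"

text \<open>Membership in L^2(\<R>^d) (for a representative function).\<close>
definition square_integrable :: "(real ^ 'd::finite \<Rightarrow> complex) \<Rightarrow> bool" where
  "square_integrable f \<longleftrightarrow> f \<in> borel_measurable lborel \<and> integrable lborel (\<lambda>t. (cmod (f t))\<^sup>2)"

definition stft :: "(real ^ 'd::finite \<Rightarrow> complex) \<Rightarrow> (real ^ 'd \<Rightarrow> complex)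
    \<Rightarrow> real ^ 'd \<Rightarrow> real ^ 'd \<Rightarrow> complex" where
  "stft g f x \<omega> = (LINT t|lborel. f t * cnj (g (t - x)) * cis (- 2 * pi * (\<omega> \<bullet> t)))"

end

theory Submission
  imports Defs
begin

text \<open>
  A row of the inverse of a matrix generating the lattice \<open>L\<close> yields \<open>(a, b)\<close> with \<open>a \<noteq> 0\<close> and \<open>b \<bullet> x - a \<bullet> \<omega> \<in> \<int>\<close> for all \<open>(x, \<omega>) \<in> L\<close>, that is, a point of
  the adjoint lattice with nonzero position part. Let \<open>h\<^sub>0\<close> be the reflection of \<open>g\<close> and \<open>h\<^sub>1\<close> the
  (symmetrically normalised) time-frequency shift of \<open>h\<^sub>0\<close> by \<open>(a, b)\<close>. A time-frequency shift
  composed with the reflection is self-adjoint, so the transforms of \<open>h\<^sub>0\<close> and \<open>h\<^sub>1\<close> are real up to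
  explicit phases, and on \<open>L\<close> these two phases agree up to sign. Hence \<open>h\<^sub>0 + \<i> h\<^sub>1\<close> and
  \<open>h\<^sub>0 - \<i> h\<^sub>1\<close> have transforms of equal modulus on \<open>L\<close>. If they agreed up to a unimodular factor,
  then \<open>\<bar>g\<bar>\<^sup>2\<close> would be an integrable function with period \<open>a \<noteq> 0\<close>, hence zero.
\<close>

section \<open>Lebesgue measure under reflections and translations\<close>

lemma distr_lborel_reflect:
  fixes c :: "'a::euclidean_space"
  shows "distr lborel borel (\<lambda>t. c - t) = lborel"
  by (subst (2) lborel_affine[of "-1" c]) (auto simp: density_1)

lemma lborel_integral_reflect:
  fixes f :: "'a::euclidean_space \<Rightarrow> 'b::{banach, second_countable_topology}"
  assumes [measurable]: "f \<in> borel_measurable lborel"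
  shows "(LINT t|lborel. f (c - t)) = (LINT t|lborel. f t)"
proof -
  have "(LINT t|distr lborel borel (\<lambda>t. c - t). f t) = (LINT t|lborel. f (c - t))"
    by (rule integral_distr) auto
  then show ?thesis
    by (simp add: distr_lborel_reflect)
qed

lemma lborel_integral_translate:
  fixes f :: "'a::euclidean_space \<Rightarrow> 'b::{banach, second_countable_topology}"
  assumes [measurable]: "f \<in> borel_measurable lborel"
  shows "(LINT t|lborel. f (c + t)) = (LINT t|lborel. f t)"
proof -
  have "(LINT t|distr lborel borel ((+) c). f t) = (LINT t|lborel. f (c + t))"
    by (rule integral_distr) auto
  then show ?thesis
    by (simp add: lborel_distr_plus)
qed

lemma AE_lborel_translate:
  fixes c :: "'a::euclidean_space"
  assumes "AE t in lborel. P t"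
  shows "AE t in lborel. P (c + t)"
proof -
  have "AE t in distr lborel borel ((+) c). P t"
    using assms by (subst lborel_distr_plus)
  then show ?thesis
    by (rule AE_distrD[rotated]) auto
qed

lemma AE_lborel_reflect:
  fixes c :: "'a::euclidean_space"
  assumes "AE t in lborel. P t"
  shows "AE t in lborel. P (c - t)"
proof -
  have "AE t in distr lborel borel (\<lambda>t. c - t). P t"
    using assms by (subst distr_lborel_reflect)
  then show ?thesis
    by (rule AE_distrD[rotated]) auto
qed

text \<open>By periodicity, the integral of \<open>u\<close> over a ball is the same as over the
  ball moved by any multiple \<open>n\<close> of \<open>a\<close>. As \<open>n\<close> grows, the
  moved ball leaves every fixed point behind, so dominated convergence with majorant
  \<open>u\<close> sends these equal integrals to 0.\<close>

lemma integrable_periodic_imp_AE_zero: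
  fixes u :: "'a::euclidean_space \<Rightarrow> real"
  assumes int: "integrable lborel u"
    and nonneg: "\<And>t. 0 \<le> u t"
    and per: "AE t in lborel. u (a + t) = u t"
    and "a \<noteq> 0"
  shows "AE t in lborel. u t = 0"
proof -
  have [measurable]: "u \<in> borel_measurable borel"
    using int by (simp add: integrable_iff_bounded)
  have pern: "AE t in lborel. u (real n *\<^sub>R a + t) = u t" for n
  proof (induction n)
    case (Suc n)
    show ?case
      using AE_lborel_translate[OF Suc, of a] per
      by eventually_elim (simp add: algebra_simps)
  qed simp
  have zero: "AE t in lborel. indicator (cball 0 R) t * u t = 0" for R :: real
  proof -
    have [measurable]: "cball (0 :: 'a) R \<in> sets borel"
      by simp
    let ?I = "LINT t|lborel. indicator (cball 0 R) t * u t"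
    let ?s = "\<lambda>n t. indicator (cball 0 R) (t - real n *\<^sub>R a) * u t"
    have eq: "(LINT t|lborel. ?s n t) = ?I" for n
    proof -
      have "(LINT t|lborel. ?s n t) = (LINT t|lborel. ?s n (real n *\<^sub>R a + t))"
        by (rule lborel_integral_translate[symmetric]) measurable
      also have "\<dots> = ?I"
        using pern[of n] by (intro integral_cong_AE) auto
      finally show ?thesis .
    qed
    have "(\<lambda>n. LINT t|lborel. ?s n t) \<longlonglongrightarrow> (LINT t|(lborel :: 'a measure). 0)"
    proof (rule integral_dominated_convergence[where w = u])
      show "AE t in lborel. (\<lambda>n. ?s n t) \<longlonglongrightarrow> 0"
      proof (rule AE_I2)
        fix t :: 'a
        \<comment> \<open>From this index on, the ball has moved by more than
          \<open>R + norm t\<close>, so it no longer contains \<open>t\<close>.\<close>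
        obtain N :: nat where N: "(R + norm t) / norm a < real N"
          using reals_Archimedean2 by blast
        have "?s n t = 0" if "n \<ge> N" for n
        proof -
          have "(R + norm t) / norm a < real n"
            using N that by linarith
          then have "R + norm t < norm (real n *\<^sub>R a)"
            using \<open>a \<noteq> 0\<close> by (simp add: field_simps)
          also have "\<dots> \<le> norm t + norm (t - real n *\<^sub>R a)"
            by (metis norm_triangle_sub norm_minus_commute)
          finally show ?thesis
            by (simp add: indicator_def dist_norm norm_minus_commute)
        qed
        then show "(\<lambda>n. ?s n t) \<longlonglongrightarrow> 0"
          by (intro tendsto_eventually) (auto simp: eventually_sequentially)
      qed
      show "AE t in lborel. norm (?s n t) \<le> u t" for n
        using nonneg by (auto simp: indicator_def)
    qed (use int in \<open>auto\<close>)
    then have "?I = 0"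
      by (simp add: eq LIMSEQ_const_iff)
    moreover have "integrable lborel (\<lambda>t. indicator (cball 0 R) t * u t)"
      by (rule Bochner_Integration.integrable_bound[OF int]) (auto simp: indicator_def nonneg)
    ultimately show ?thesis
      using nonneg by (subst (asm) integral_nonneg_eq_0_iff_AE) auto
  qed
  have "AE t in lborel. \<forall>n::nat. indicator (cball 0 (real n)) t * u t = 0"
    using zero by (subst AE_all_countable) auto
  then show ?thesis
  proof eventually_elim
    case (elim t)
    obtain n :: nat where "norm t \<le> real n"
      using real_arch_simple by blast
    with elim[rule_format, of n] show ?case
      by (simp add: indicator_def)
  qed
qed

section \<open>Closure properties of square integrable functions\<close>

lemma square_integrable_comp_reflect:
  assumes "square_integrable f"
  shows "square_integrable (\<lambda>t. f (c - t))"
proof -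
  have [measurable]: "f \<in> borel_measurable borel"
    using assms by (simp add: square_integrable_def)
  have "integrable (distr lborel borel (\<lambda>t. c - t)) (\<lambda>t. (cmod (f t))\<^sup>2)"
    using assms by (simp add: distr_lborel_reflect square_integrable_def)
  then have "integrable lborel (\<lambda>t. (cmod (f (c - t)))\<^sup>2)"
    by (rule integrable_distr[rotated]) simp
  then show ?thesis
    by (simp add: square_integrable_def)
qed

lemma square_integrable_comp_diff:
  assumes "square_integrable f"
  shows "square_integrable (\<lambda>t. f (t - c))"
  \<comment> \<open>Two reflections compose to a translation:
    \<open>0 - (c - t) = t - c\<close>.\<close>
  using square_integrable_comp_reflect[OF square_integrable_comp_reflect[OF assms, of "0"], of c]
  by simp

lemma square_integrable_unimodular_mult:
  assumes "square_integrable f" and [measurable]: "u \<in> borel_measurable borel"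
    and "\<And>t. cmod (u t) = 1"
  shows "square_integrable (\<lambda>t. u t * f t)"
  using assms by (auto simp: square_integrable_def norm_mult)

lemma square_integrable_add:
  assumes "square_integrable f" "square_integrable h"
  shows "square_integrable (\<lambda>t. f t + h t)"
proof -
  have [measurable]: "f \<in> borel_measurable borel" "h \<in> borel_measurable borel"
    using assms by (simp_all add: square_integrable_def)
  have "integrable lborel (\<lambda>t. 2 * (cmod (f t))\<^sup>2 + 2 * (cmod (h t))\<^sup>2)"
    using assms by (simp add: square_integrable_def)
  then have "integrable lborel (\<lambda>t. (cmod (f t + h t))\<^sup>2)"
  proof (rule Bochner_Integration.integrable_bound)
    have "(cmod (f t + h t))\<^sup>2 \<le> 2 * (cmod (f t))\<^sup>2 + 2 * (cmod (h t))\<^sup>2" for t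
    proof -
      have "(cmod (f t + h t))\<^sup>2 \<le> (cmod (f t) + cmod (h t))\<^sup>2"
        by (intro power_mono norm_triangle_ineq) simp
      also have "\<dots> \<le> 2 * (cmod (f t))\<^sup>2 + 2 * (cmod (h t))\<^sup>2"
        using sum_squares_bound[of "cmod (f t)" "cmod (h t)"] by (simp add: power2_sum)
      finally show ?thesis .
    qed
    then show "AE t in lborel. norm ((cmod (f t + h t))\<^sup>2)
        \<le> norm (2 * (cmod (f t))\<^sup>2 + 2 * (cmod (h t))\<^sup>2)"
      by (auto intro!: AE_I2 order_trans[OF _ abs_ge_self])
  qed simp
  then show ?thesis
    by (simp add: square_integrable_def)
qed

section \<open>The short-time Fourier transform and shifted reflections of the window\<close>

lemma borel_measurable_cis [measurable (raw)]:
  "f \<in> borel_measurable M \<Longrightarrow> (\<lambda>x. cis (f x)) \<in> borel_measurable M"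
  by (rule borel_measurable_continuous_on[of cis]) (intro continuous_intros)

lemma borel_measurable_cnj [measurable (raw)]:
  "f \<in> borel_measurable M \<Longrightarrow> (\<lambda>x. cnj (f x)) \<in> borel_measurable M"
  by (rule borel_measurable_continuous_on[of cnj]) (intro continuous_intros)

lemma integrable_stft_integrand:
  assumes "square_integrable f" "square_integrable g"
  shows "integrable lborel (\<lambda>t. f t * cnj (g (t - x)) * cis (- 2 * pi * (\<omega> \<bullet> t)))"
proof -
  have g': "square_integrable (\<lambda>t. g (t - x))"
    by (rule square_integrable_comp_diff[OF assms(2)])
  have [measurable]: "f \<in> borel_measurable borel" "g \<in> borel_measurable borel"
    using assms by (simp_all add: square_integrable_def)
  have "integrable lborel (\<lambda>t. (cmod (f t))\<^sup>2 + (cmod (g (t - x)))\<^sup>2)"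
    using assms(1) g' by (simp add: square_integrable_def)
  then show ?thesis
  proof (rule Bochner_Integration.integrable_bound)
    have "cmod (f t) * cmod (g (t - x)) \<le> (cmod (f t))\<^sup>2 + (cmod (g (t - x)))\<^sup>2" for t
      using sum_squares_bound[of "cmod (f t)" "cmod (g (t - x))"]
        mult_nonneg_nonneg[OF norm_ge_zero[of "f t"] norm_ge_zero[of "g (t - x)"]]
      by linarith
    then show "AE t in lborel. norm (f t * cnj (g (t - x)) * cis (- 2 * pi * (\<omega> \<bullet> t)))
        \<le> norm ((cmod (f t))\<^sup>2 + (cmod (g (t - x)))\<^sup>2)"
      by (auto intro!: AE_I2 simp: norm_mult)
  qed measurable
qed

lemma stft_add_cmult:
  assumes "square_integrable g" "square_integrable f" "square_integrable h"
  shows "stft g (\<lambda>t. f t + c * h t) x \<omega> = stft g f x \<omega> + c * stft g h x \<omega>"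
proof -
  have "stft g (\<lambda>t. f t + c * h t) x \<omega> =
      (LINT t|lborel. f t * cnj (g (t - x)) * cis (- 2 * pi * (\<omega> \<bullet> t))
        + c * (h t * cnj (g (t - x)) * cis (- 2 * pi * (\<omega> \<bullet> t))))"
    unfolding stft_def by (simp add: algebra_simps)
  also have "\<dots> = stft g f x \<omega> + c * stft g h x \<omega>"
    unfolding stft_def using integrable_stft_integrand[of _ g x \<omega>] assms
    by (subst Bochner_Integration.integral_add) auto
  finally show ?thesis .
qed

text \<open>The constant phase \<open>cis (- pi * (b \<bullet> a))\<close> symmetrises the time-frequency shift.\<close>

definition shifted_reflection ::
  "real ^ 'd::finite \<Rightarrow> real ^ 'd \<Rightarrow> (real ^ 'd \<Rightarrow> complex) \<Rightarrow> real ^ 'd \<Rightarrow> complex" where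
  "shifted_reflection a b g t = cis (2 * pi * (b \<bullet> t) - pi * (b \<bullet> a)) * g (a - t)"

lemma square_integrable_shifted_reflection:
  assumes "square_integrable g"
  shows "square_integrable (shifted_reflection a b g)"
  unfolding shifted_reflection_def[abs_def]
  by (intro square_integrable_unimodular_mult square_integrable_comp_reflect assms) auto

text \<open>The substitution of \<open>a + x - t\<close> for \<open>t\<close> swaps the arguments
  \<open>a - t\<close> and \<open>t - x\<close> of the two window factors and so conjugates their
  product. The exponentials are conjugated as well, up to a phase independent of \<open>t\<close>,
  which leaves the integral.\<close>

lemma stft_shifted_reflection_eq_cnj:
  assumes "square_integrable g"
  shows "stft g (shifted_reflection a b g) x \<omega> =
    cis (2 * pi * (b \<bullet> x - a \<bullet> \<omega> - \<omega> \<bullet> x)) * cnj (stft g (shifted_reflection a b g) x \<omega>)"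
proof -
  let ?F = "\<lambda>t. shifted_reflection a b g t * cnj (g (t - x)) * cis (- 2 * pi * (\<omega> \<bullet> t))"
  let ?e = "cis (2 * pi * (b \<bullet> x - a \<bullet> \<omega> - \<omega> \<bullet> x))"
  have [measurable]: "g \<in> borel_measurable borel"
    using assms by (simp add: square_integrable_def)
  have refl: "?F (a + x - t) = ?e * cnj (?F t)" for t
  proof -
    \<comment> \<open>The terms in \<open>b \<bullet> a\<close> balance thanks to the symmetrising
      constant: both sides contain it with coefficient \<open>pi\<close>.\<close>
    have "2 * pi * (b \<bullet> (a + x - t)) - pi * (b \<bullet> a) + (- 2 * pi * (\<omega> \<bullet> (a + x - t)))
        = 2 * pi * (b \<bullet> x - a \<bullet> \<omega> - \<omega> \<bullet> x)
          + (- (2 * pi * (b \<bullet> t) - pi * (b \<bullet> a)) + - (- 2 * pi * (\<omega> \<bullet> t)))"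
      by (simp add: inner_add_right inner_diff_right inner_commute algebra_simps)
    then have "cis (2 * pi * (b \<bullet> (a + x - t)) - pi * (b \<bullet> a)) * cis (- 2 * pi * (\<omega> \<bullet> (a + x - t)))
        = ?e * (cnj (cis (2 * pi * (b \<bullet> t) - pi * (b \<bullet> a))) * cnj (cis (- 2 * pi * (\<omega> \<bullet> t))))"
      by (simp only: cis_mult cis_cnj)
    moreover have "a - (a + x - t) = t - x" "a + x - t - x = a - t"
      by simp_all
    ultimately show ?thesis
      by (simp only: shifted_reflection_def complex_cnj_mult complex_cnj_cnj mult_ac)
  qed
  have "stft g (shifted_reflection a b g) x \<omega> = (LINT t|lborel. ?F (a + x - t))"
    unfolding stft_def shifted_reflection_def
    by (rule lborel_integral_reflect[symmetric]) measurable
  also have "\<dots> = ?e * (LINT t|lborel. cnj (?F t))"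
    unfolding refl by (rule integral_mult_right_zero)
  also have "\<dots> = ?e * cnj (stft g (shifted_reflection a b g) x \<omega>)"
    unfolding stft_def by (simp only: Bochner_Integration.integral_cnj)
  finally show ?thesis .
qed

text \<open>Integrality removes \<open>b \<bullet> x - a \<bullet> \<omega>\<close> from the phase.
  Both transforms then satisfy \<open>V = c * cnj V\<close> with the same
  \<open>c = cis (- 2 * pi * (\<omega> \<bullet> x))\<close>, so the product equals its own
  conjugate.\<close>

lemma stft_shifted_reflection_mult_cnj_real:
  assumes "square_integrable g" and "b \<bullet> x - a \<bullet> \<omega> \<in> \<int>"
  shows "stft g (shifted_reflection 0 0 g) x \<omega> * cnj (stft g (shifted_reflection a b g) x \<omega>) \<in> \<real>"
proof -
  let ?I = "stft g (shifted_reflection 0 0 g) x \<omega>" and ?J = "stft g (shifted_reflection a b g) x \<omega>"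
  obtain n :: int where n: "b \<bullet> x - a \<bullet> \<omega> = of_int n"
    using assms(2) Ints_cases by blast
  have "cis (2 * pi * (b \<bullet> x - a \<bullet> \<omega> - \<omega> \<bullet> x)) = cis (2 * pi * of_int n) * cis (- 2 * pi * (\<omega> \<bullet> x))"
    unfolding n cis_mult by (simp add: algebra_simps)
  then have J: "?J = cis (- 2 * pi * (\<omega> \<bullet> x)) * cnj ?J"
    using stft_shifted_reflection_eq_cnj[OF assms(1), of a b x \<omega>] cis_multiple_2pi[of "of_int n"]
    by simp
  have I: "?I = cis (- 2 * pi * (\<omega> \<bullet> x)) * cnj ?I"
    using stft_shifted_reflection_eq_cnj[OF assms(1), of 0 0 x \<omega>] by simp
  have "cnj (?I * cnj ?J) = cnj ?I * (cis (- 2 * pi * (\<omega> \<bullet> x)) * cnj ?J)"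
    using J by simp
  also have "\<dots> = ?I * cnj ?J"
    using I by (metis mult.assoc mult.commute)
  finally show ?thesis
    by (simp add: Reals_cnj_iff)
qed

section \<open>Equal moduli without equality up to a phase\<close>

text \<open>The squares of the two moduli differ by \<open>4 * Im (z * cnj w)\<close>.\<close>

lemma cmod_add_i_eq_cmod_diff_i:
  assumes "z * cnj w \<in> \<real>"
  shows "cmod (z + \<i> * w) = cmod (z + - \<i> * w)"
proof -
  have "Im z * Re w = Re z * Im w"
    using assms by (simp add: complex_is_Real_iff)
  then show ?thesis
    unfolding cmod_def by (simp add: power2_eq_square algebra_simps)
qed

text \<open>Rearranging gives \<open>(1 - \<nu>) * h 0 0 t = - \<i> * (1 + \<nu>) * h a b t\<close>.
  Moduli turn this into a relation between \<open>u\<close> and its translate by \<open>a\<close>;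
  comparing integrals makes the two coefficients equal, and periodicity of \<open>u\<close>
  results.\<close>

lemma not_AE_unimodular_multiple:
  fixes g :: "real ^ 'd::finite \<Rightarrow> complex"
  defines "h \<equiv> \<lambda>a b. shifted_reflection a b g"
  assumes g: "square_integrable g" and nz: "\<not> (AE t in lborel. g t = 0)" and "a \<noteq> 0"
  shows "\<not> (AE t in lborel. h 0 0 t + \<i> * h a b t = \<nu> * (h 0 0 t + - \<i> * h a b t))"
proof
  assume ae: "AE t in lborel. h 0 0 t + \<i> * h a b t = \<nu> * (h 0 0 t + - \<i> * h a b t)"
  define u where "u t = (cmod (g t))\<^sup>2" for t
  define p q where "p = (cmod (1 - \<nu>))\<^sup>2" and "q = (cmod (1 + \<nu>))\<^sup>2"
  have int: "integrable lborel u" and [measurable]: "u \<in> borel_measurable borel"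
    using g unfolding u_def by (auto simp: square_integrable_def)
  have "AE t in lborel. p * u (0 - t) = q * u (a - t)"
    using ae
  proof eventually_elim
    case (elim t)
    then have "(1 - \<nu>) * h 0 0 t = - \<i> * ((1 + \<nu>) * h a b t)"
      by (simp add: algebra_simps)
    then have "cmod (1 - \<nu>) * cmod (h 0 0 t) = cmod (1 + \<nu>) * cmod (h a b t)"
      by (metis norm_mult norm_minus_cancel norm_ii mult_1)
    then have "(cmod (1 - \<nu>) * cmod (h 0 0 t))\<^sup>2 = (cmod (1 + \<nu>) * cmod (h a b t))\<^sup>2"
      by simp
    then show ?case
      by (simp add: p_def q_def u_def h_def shifted_reflection_def norm_mult power_mult_distrib)
  qed
  \<comment> \<open>Replacing \<open>t\<close> by \<open>- t\<close> undoes the reflection built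
    into the functions \<open>h\<close>.\<close>
  from AE_lborel_reflect[OF this, of 0] have pq: "AE t in lborel. p * u t = q * u (a + t)"
    by simp
  then have "(LINT t|lborel. p * u t) = (LINT t|lborel. q * u (a + t))"
    by (intro integral_cong_AE) auto
  also have "\<dots> = q * (LINT t|lborel. u t)"
    using lborel_integral_translate[of u a] by simp
  finally have "p * (LINT t|lborel. u t) = q * (LINT t|lborel. u t)"
    by simp
  moreover have "(LINT t|lborel. u t) \<noteq> 0"
    using nz by (subst integral_nonneg_eq_0_iff_AE[OF int]) (auto simp: u_def)
  ultimately have "p = q"
    by simp
  \<comment> \<open>If \<open>p = q = 0\<close>, then \<open>\<nu>\<close> would be both 1 and
    -1.\<close>
  have "p \<noteq> 0"
  proof
    assume "p = 0"
    then have "1 - \<nu> = 0" "1 + \<nu> = 0"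
      using \<open>p = q\<close> by (simp_all only: p_def q_def power_eq_0_iff norm_eq_zero) auto
    then show False
      by (simp add: add_eq_0_iff)
  qed
  with pq \<open>p = q\<close> have "AE t in lborel. u (a + t) = u t"
    by auto
  then have "AE t in lborel. u t = 0"
    using integrable_periodic_imp_AE_zero[OF int] \<open>a \<noteq> 0\<close> by (simp add: u_def)
  with nz show False
    by (simp add: u_def)
qed

section \<open>A point of the adjoint lattice with nonzero position part\<close>

lemma lattice_adjoint_point:
  fixes L :: "(real ^ ('d::finite + 'd)) set"
  assumes "is_lattice L"
  obtains a b where "a \<noteq> 0" "\<And>z. z \<in> L \<Longrightarrow> b \<bullet> pos z - a \<bullet> freq z \<in> \<int>"
proof -
  obtain M :: "real ^ ('d + 'd) ^ ('d + 'd)" where M: "invertible M" "L = (\<lambda>k. M *v k) ` int_vecs"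
    using assms unfolding is_lattice_def by blast
  then obtain N where N: "M ** N = mat 1" "N ** M = mat 1"
    by (auto simp: invertible_def)
  \<comment> \<open>If all frequency columns of \<open>N\<close> vanished, so would those of
    \<open>M ** N\<close>, which is the identity.\<close>
  have "\<exists>i j. N $ i $ Inr j \<noteq> 0"
  proof (rule ccontr)
    assume "\<not> ?thesis"
    then have "(M ** N) $ Inr j $ Inr j = 0" for j
      by (simp add: matrix_matrix_mult_def)
    then show False
      by (simp add: N mat_def)
  qed
  then obtain i j where ij: "N $ i $ Inr j \<noteq> 0"
    by blast
  show thesis
  proof
    \<comment> \<open>\<open>b\<close> is the position half of row \<open>i\<close> of
      \<open>N\<close> and \<open>a\<close> the negated frequency half, so
      \<open>b \<bullet> pos z - a \<bullet> freq z\<close> is the \<open>i\<close>-th integer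
      coordinate of \<open>z\<close> in the lattice basis.\<close>
    show "(\<chi> j. - N $ i $ Inr j) \<noteq> 0"
      using ij by (auto simp: vec_eq_iff)
    fix z assume "z \<in> L"
    then obtain k where k: "k \<in> int_vecs" "z = M *v k"
      using M by auto
    have "N *v z = k"
      by (simp add: k matrix_vector_mul_assoc N)
    then have "k $ i = (\<Sum>l\<in>UNIV. N $ i $ l * z $ l)"
      by (auto simp: matrix_vector_mult_def)
    also have "\<dots> = (\<Sum>l\<in>UNIV. N $ i $ Inl l * z $ Inl l) + (\<Sum>l\<in>UNIV. N $ i $ Inr l * z $ Inr l)"
      unfolding UNIV_Plus_UNIV[symmetric] by (subst sum.Plus) auto
    also have "\<dots> = (\<chi> j. N $ i $ Inl j) \<bullet> pos z - (\<chi> j. - N $ i $ Inr j) \<bullet> freq z"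
      by (simp add: inner_vec_def pos_def freq_def sum_negf)
    finally have "(\<chi> j. N $ i $ Inl j) \<bullet> pos z - (\<chi> j. - N $ i $ Inr j) \<bullet> freq z = k $ i"
      by (rule sym)
    then show "(\<chi> j. N $ i $ Inl j) \<bullet> pos z - (\<chi> j. - N $ i $ Inr j) \<bullet> freq z \<in> \<int>"
      using k(1) by (simp only: int_vecs_def mem_Collect_eq)
  qed
qed

section \<open>Choice of the two functions for a given window\<close>

theorem theorem1p2:
  fixes L :: "(real ^ ('d::finite + 'd)) set"
    and g :: "real ^ 'd \<Rightarrow> complex"
  assumes L_lattice: "is_lattice L"
    and cases:
      "(\<exists>\<alpha>>0. \<exists>S. symplectic S \<and> L = (\<lambda>k. \<alpha> *\<^sub>R (S *v k)) ` int_vecs)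
     \<or> (\<exists>D. diagonal_mat D \<and> invertible D \<and> L = (\<lambda>k. D *v k) ` int_vecs)
     \<or> (\<exists>A B :: (real ^ 'd) set. is_lattice A \<and> is_lattice B \<and>
           L = {z. pos z \<in> A \<and> freq z \<in> B})
     \<or> (\<exists>\<alpha> \<beta> :: real. \<alpha> \<noteq> 0 \<and> \<beta> \<noteq> 0 \<and>
           L = {z. pos z \<in> (\<lambda>k. \<alpha> *\<^sub>R k) ` int_vecs \<and> freq z \<in> (\<lambda>k. \<beta> *\<^sub>R k) ` int_vecs})"
    and g_L2: "square_integrable g"
  shows "\<exists>f1 f2. square_integrable f1 \<and> square_integrable f2 \<and>
           (\<forall>z\<in>L. cmod (stft g f1 (pos z) (freq z)) = cmod (stft g f2 (pos z) (freq z))) \<and>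
           \<not> (\<exists>\<nu>::complex. cmod \<nu> = 1 \<and> (AE t in lborel. f1 t = \<nu> * f2 t))"
proof (cases "AE t in lborel. g t = 0")
  case True
  \<comment> \<open>For a window vanishing almost everywhere all transforms are zero, so a nonzero
    function and the zero function suffice.\<close>
  let ?f = "indicator (cball 0 1) :: real ^ 'd \<Rightarrow> complex"
  have "square_integrable ?f"
  proof -
    have "(\<lambda>t. (cmod (?f t))\<^sup>2) = (indicator (cball 0 1) :: real ^ 'd \<Rightarrow> real)"
      by (auto simp: indicator_def)
    moreover have "integrable lborel (indicator (cball 0 1) :: real ^ 'd \<Rightarrow> real)"
      by (rule integrable_real_indicator) (use emeasure_lborel_cball_finite in auto)
    ultimately show ?thesis
      unfolding square_integrable_def by (simp add: borel_measurable_indicator)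
  qed
  moreover have "square_integrable (\<lambda>t :: real ^ 'd. 0 :: complex)"
    by (simp add: square_integrable_def)
  moreover have "stft g f x \<omega> = 0" for f x \<omega>
  proof -
    have "AE t in lborel. f t * cnj (g (t - x)) * cis (- 2 * pi * (\<omega> \<bullet> t)) = 0"
      using AE_lborel_translate[OF True, of "- x"] by eventually_elim simp
    then show ?thesis
      unfolding stft_def by (rule integral_eq_zero_AE)
  qed
  moreover have "\<not> (AE t in lborel. ?f t = \<nu> * 0)" for \<nu>
  proof
    assume "AE t in lborel. ?f t = \<nu> * 0"
    then have "AE t in lborel. t \<notin> cball (0 :: real ^ 'd) 1"
      by eventually_elim (auto simp: indicator_def)
    then have "emeasure lborel (cball (0 :: real ^ 'd) 1) = 0"
      by (subst (asm) AE_iff_measurable[OF _ refl]) (auto simp: cball_def)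
    then have "measure lborel (cball (0 :: real ^ 'd) 1) = 0"
      by (simp add: measure_def)
    then show False
      using content_cball_pos[of 1 "0 :: real ^ 'd"] by simp
  qed
  ultimately show ?thesis
    by (intro exI[of _ ?f] exI[of _ "\<lambda>t. 0"]) auto
next
  case False
  obtain a b where "a \<noteq> 0" and ab: "\<And>z. z \<in> L \<Longrightarrow> b \<bullet> pos z - a \<bullet> freq z \<in> \<int>"
    using lattice_adjoint_point[OF L_lattice] by blast
  let ?h0 = "shifted_reflection 0 0 g" and ?h1 = "shifted_reflection a b g"
  have sq: "square_integrable ?h0" "square_integrable ?h1"
    by (rule square_integrable_shifted_reflection[OF g_L2])+
  have sqc: "square_integrable (\<lambda>t. ?h0 t + c * ?h1 t)" if "cmod c = 1" for c
    by (intro square_integrable_add square_integrable_unimodular_mult sq) (auto simp: that)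
  \<comment> \<open>By linearity the transforms are \<open>v + \<i> * w\<close> and
    \<open>v - \<i> * w\<close>, where \<open>v\<close> and \<open>w\<close> are the transforms of
    \<open>?h0\<close> and \<open>?h1\<close>, and \<open>v * cnj w\<close> is real on
    \<open>L\<close>.\<close>
  have "cmod (stft g (\<lambda>t. ?h0 t + \<i> * ?h1 t) (pos z) (freq z))
      = cmod (stft g (\<lambda>t. ?h0 t + - \<i> * ?h1 t) (pos z) (freq z))" if "z \<in> L" for z
    unfolding stft_add_cmult[OF g_L2 sq]
    by (intro cmod_add_i_eq_cmod_diff_i stft_shifted_reflection_mult_cnj_real g_L2 ab that)
  moreover note not_AE_unimodular_multiple[OF g_L2 False \<open>a \<noteq> 0\<close>, of b]
  moreover have "square_integrable (\<lambda>t. ?h0 t + \<i> * ?h1 t)"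
    "square_integrable (\<lambda>t. ?h0 t + - \<i> * ?h1 t)"
    by (rule sqc; simp)+
  ultimately show ?thesis
    by blast
qed

end
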